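(* Let $R$ be a commutative ring with nonzero identity and define \[ \rho:EC(R^\#)\longrightarrow\mathcal R_{\mathrm{pr}}(R),\qquad \rho([a])=\sqrt{aR}. \] Then the following statements hold. (1) The map $\rho$ is well defined and surjective, and $B_a=\rho^{-1}(\uparrow\sqrt{aR})$ for every $a\in R^\#$. (2) For $a,b\in R^\#$, the points $[a]$ and $[b]$ are topologically indistinguishable in $GD(R)$ if and only if $\sqrt{aR}=\sqrt{bR}$. (3) The map $\rho$ induces a homeomorphism $KQ(GD(R))\cong\mathcal R_{\mathrm{pr}}(R)$, where $\mathcal R_{\mathrm{pr}}(R)$ carries the upper Alexandrov topology.
   Context: For a commutative ring $R$ with nonzero identity and unit group $U(R)$, let $R^\#=R\setminus(U(R)\cup\{0\})$ be the set of nonzero nonunits. For $a,b\in R^\#$ write $a\sim b$ if $aR=bR$; $[a]$ denotes the equivalence class of $a$ and $EC(R^\#)$ the set of equivalence classes. For $a\in R^\#$ put $B_a=\{[b]\in EC(R^\#): b\mid a^n\text{ for some }n\geq 1\}$. The sets $B_a$ ($a\in R^\#$) form a basis of a topology on $EC(R^\#)$; the resulting space is denoted $GD(R)$ (the generalized divisor topology). $\mathcal R_{\mathrm{pr}}(R)=\{\sqrt{aR}:a\in R^\#\}$ is partially ordered by inclusion. For a poset $(P,\leq)$ and $x\in P$, $\uparrow x=\{y\in P:x\leq y\}$; the upper Alexandrov topology on $P$ is the topology whose open sets are exactly the upper sets (sets $U$ such that $x\in U$ and $x\leq y$ imply $y\in U$). Two points of a topological space $X$ are topologically indistinguishable if they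 have the same open neighbourhoods; the Kolmogorov quotient $KQ(X)$ is the quotient of $X$ by this equivalence relation with the quotient topology. *)

theory Defs
  imports
    "HOL-Algebra.Divisibility"
    "HOL-Algebra.Ideal"
    "HOL-Analysis.Abstract_Topology"
begin

definition upper_closure :: "'a set \<Rightarrow> ('a \<Rightarrow> 'a \<Rightarrow> bool) \<Rightarrow> 'a \<Rightarrow> 'a set" where
  "upper_closure P leq x = {y \<in> P. leq x y}"

definition upper_set :: "'a set \<Rightarrow> ('a \<Rightarrow> 'a \<Rightarrow> bool) \<Rightarrow> 'a set \<Rightarrow> bool" where
  "upper_set P leq U \<longleftrightarrow> U \<subseteq> P \<and> (\<forall>x\<in>U. \<forall>y\<in>P. leq x y \<longrightarrow> y \<in> U)"

definition upper_alexandrov :: "'a set \<Rightarrow> ('a \<Rightarrow> 'a \<Rightarrow> bool) \<Rightarrow> 'a topology" where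
  "upper_alexandrov P leq = topology (upper_set P leq)"

lemma openin_upper_alexandrov: "openin (upper_alexandrov P leq) U \<longleftrightarrow> upper_set P leq U"
proof -
  have "istopology (upper_set P leq)"
    unfolding istopology_def upper_set_def by blast
  then show ?thesis
    by (simp add: upper_alexandrov_def topology_inverse')
qed

lemma topspace_upper_alexandrov: "topspace (upper_alexandrov P leq) = P"
  unfolding topspace_def openin_upper_alexandrov by (auto simp: upper_set_def)

text \<open>The points of the quotient are the classes \<open>r `` {x}\<close>; a set of classes is open iff its
  preimage under the projection \<open>x \<mapsto> r `` {x}\<close> is open.\<close>

definition quotient_topology :: "'a topology \<Rightarrow> ('a \<times> 'a) set \<Rightarrow> 'a set topology" where
  "quotient_topology X r =
     topology (\<lambda>V. V \<subseteq> topspace X // r \<and> openin X {x \<in> topspace X. r `` {x} \<in> V})"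

lemma openin_quotient_topology:
  "openin (quotient_topology X r) V \<longleftrightarrow>
     V \<subseteq> topspace X // r \<and> openin X {x \<in> topspace X. r `` {x} \<in> V}"
proof -
  have int: "{x \<in> topspace X. r `` {x} \<in> S \<inter> T} =
      {x \<in> topspace X. r `` {x} \<in> S} \<inter> {x \<in> topspace X. r `` {x} \<in> T}" for S T
    by blast
  have un: "{x \<in> topspace X. r `` {x} \<in> \<Union>K} = (\<Union>S\<in>K. {x \<in> topspace X. r `` {x} \<in> S})" for K
    by blast
  have "istopology (\<lambda>V. V \<subseteq> topspace X // r \<and> openin X {x \<in> topspace X. r `` {x} \<in> V})"
    unfolding istopology_def int un by (auto intro!: openin_Int openin_Union)
  then show ?thesis
    by (simp add: quotient_topology_def topology_inverse')
qed

lemma topspace_quotient_topology: "topspace (quotient_topology X r) = topspace X // r"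
proof -
  have "{x \<in> topspace X. r `` {x} \<in> topspace X // r} = topspace X"
    by (auto intro: quotientI)
  then have "openin (quotient_topology X r) (topspace X // r)"
    by (simp add: openin_quotient_topology)
  then show ?thesis
    by (metis openin_quotient_topology openin_subset openin_topspace subset_antisym)
qed

definition indistinguishable :: "'a topology \<Rightarrow> 'a \<Rightarrow> 'a \<Rightarrow> bool" where
  "indistinguishable X x y \<longleftrightarrow> (\<forall>U. openin X U \<longrightarrow> (x \<in> U \<longleftrightarrow> y \<in> U))"

definition indist_rel :: "'a topology \<Rightarrow> ('a \<times> 'a) set" where
  "indist_rel X = {(x, y). x \<in> topspace X \<and> y \<in> topspace X \<and> indistinguishable X x y}"

lemma equiv_indist_rel: "equiv (topspace X) (indist_rel X)"
  by (rule equivI)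
    (auto simp: indist_rel_def indistinguishable_def refl_on_def sym_def intro!: transI)

text \<open>\<open>Kolmogorov_quotient\<close> of HOL-Analysis selects a representative of each class; here the points
  are the classes themselves.\<close>

definition KQ :: "'a topology \<Rightarrow> 'a set topology" where
  "KQ X = quotient_topology X (indist_rel X)"

definition nonzero_nonunits :: "('a, 'm) ring_scheme \<Rightarrow> 'a set" where
  "nonzero_nonunits R = carrier R - (Units R \<union> {\<zero>\<^bsub>R\<^esub>})"

definition ec_rel :: "('a, 'm) ring_scheme \<Rightarrow> ('a \<times> 'a) set" where
  "ec_rel R = {(a, b). a \<in> nonzero_nonunits R \<and> b \<in> nonzero_nonunits R \<and>
     PIdl\<^bsub>R\<^esub> a = PIdl\<^bsub>R\<^esub> b}"

lemma equiv_ec_rel: "equiv (nonzero_nonunits R) (ec_rel R)"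
  by (rule equivI) (auto simp: ec_rel_def refl_on_def sym_def intro!: transI)

definition ec :: "('a, 'm) ring_scheme \<Rightarrow> 'a \<Rightarrow> 'a set" where
  "ec R a = ec_rel R `` {a}"

definition EC :: "('a, 'm) ring_scheme \<Rightarrow> 'a set set" where
  "EC R = nonzero_nonunits R // ec_rel R"

definition basic_open :: "('a, 'm) ring_scheme \<Rightarrow> 'a \<Rightarrow> 'a set set" where
  "basic_open R a =
     {ec R b | b. b \<in> nonzero_nonunits R \<and> (\<exists>n::nat. n \<ge> 1 \<and> b divides\<^bsub>R\<^esub> (a [^]\<^bsub>R\<^esub> n))}"

definition GD :: "('a, 'm) ring_scheme \<Rightarrow> 'a set topology" where
  "GD R = topology (arbitrary union_of (\<lambda>B. B \<in> basic_open R ` nonzero_nonunits R))"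

definition radical :: "('a, 'm) ring_scheme \<Rightarrow> 'a set \<Rightarrow> 'a set" where
  "radical R I = {x \<in> carrier R. \<exists>n::nat. n \<ge> 1 \<and> x [^]\<^bsub>R\<^esub> n \<in> I}"

definition Rpr :: "('a, 'm) ring_scheme \<Rightarrow> 'a set set" where
  "Rpr R = {radical R (PIdl\<^bsub>R\<^esub> a) | a. a \<in> nonzero_nonunits R}"

text \<open>The image of a class \<open>C\<close> is the single element of the set of all \<open>\<surd>(aR)\<close> with \<open>a \<in> C\<close>.
  That this set is a singleton is the well-definedness of \<open>\<rho>\<close>.\<close>

definition rho :: "('a, 'm) ring_scheme \<Rightarrow> 'a set \<Rightarrow> 'a set" where
  "rho R C = the_elem ((\<lambda>a. radical R (PIdl\<^bsub>R\<^esub> a)) ` C)"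

lemma ec_eq_iff:
  assumes "a \<in> nonzero_nonunits R" "b \<in> nonzero_nonunits R"
  shows "ec R a = ec R b \<longleftrightarrow> PIdl\<^bsub>R\<^esub> a = PIdl\<^bsub>R\<^esub> b"
  unfolding ec_def using eq_equiv_class_iff[OF equiv_ec_rel assms] assms
  by (auto simp: ec_rel_def)

context cring
begin

lemma PIdl_eq_imp_divides:
  assumes a: "a \<in> carrier R" and b: "b \<in> carrier R" and eq: "PIdl a = PIdl b"
  shows "b divides a"
proof -
  have "a \<in> PIdl b"
    using cgenideal_self[OF a] eq by simp
  then obtain x where "x \<in> carrier R" "a = x \<otimes> b"
    by (auto simp: cgenideal_def)
  then show ?thesis
    unfolding factor_def using b m_comm by blast
qed

lemma ec_in_basic_open_iff:
  assumes c: "c \<in> nonzero_nonunits R" and a: "a \<in> nonzero_nonunits R"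
  shows "ec R c \<in> basic_open R a \<longleftrightarrow> (\<exists>n::nat. n \<ge> 1 \<and> c divides (a [^] n))"
proof
  assume "ec R c \<in> basic_open R a"
  then obtain b and n :: nat where b: "b \<in> nonzero_nonunits R" "ec R c = ec R b"
    and n: "n \<ge> 1" "b divides (a [^] n)"
    by (auto simp: basic_open_def)
  have cr: "a \<in> carrier R" "b \<in> carrier R" "c \<in> carrier R"
    using a b c by (auto simp: nonzero_nonunits_def)
  have "c divides b"
    using ec_eq_iff[OF c b(1)] b(2) PIdl_eq_imp_divides cr by simp
  then show "\<exists>n::nat. n \<ge> 1 \<and> c divides (a [^] n)"
    using n divides_trans cr by blast
qed (use c in \<open>auto simp: basic_open_def\<close>)

lemma basic_open_mono:
  assumes c: "c \<in> nonzero_nonunits R" and a: "a \<in> nonzero_nonunits R"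
    and ca: "ec R c \<in> basic_open R a"
  shows "basic_open R c \<subseteq> basic_open R a"
proof
  fix C assume "C \<in> basic_open R c"
  then obtain d and m :: nat where d: "C = ec R d" "d \<in> nonzero_nonunits R"
    and m: "m \<ge> 1" "d divides (c [^] m)"
    by (auto simp: basic_open_def)
  obtain n :: nat where n: "n \<ge> 1" "c divides (a [^] n)"
    using ca ec_in_basic_open_iff[OF c a] by blast
  have cr: "a \<in> carrier R" "c \<in> carrier R" "d \<in> carrier R"
    using a c d by (auto simp: nonzero_nonunits_def)
  obtain x where x: "x \<in> carrier R" "a [^] n = c \<otimes> x"
    using n by (auto simp: factor_def)
  have "a [^] (n * m) = c [^] m \<otimes> x [^] m"
    using x cr by (simp flip: nat_pow_pow add: nat_pow_distrib)
  then have "(c [^] m) divides (a [^] (n * m))"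
    using x by (auto simp: factor_def)
  then have "d divides (a [^] (n * m))"
    using m cr divides_trans by blast
  moreover have "n * m \<ge> 1"
    using n m by simp
  ultimately show "C \<in> basic_open R a"
    using d ec_in_basic_open_iff[OF d(2) a] by blast
qed

lemma ec_in_basic_open_self:
  assumes a: "a \<in> nonzero_nonunits R"
  shows "ec R a \<in> basic_open R a"
proof -
  have "a divides (a [^] (1::nat))"
    using a by (simp add: nonzero_nonunits_def)
  then show ?thesis
    using ec_in_basic_open_iff[OF a a] by blast
qed

lemma openin_GD:
  "openin (GD R) = arbitrary union_of (\<lambda>B. B \<in> basic_open R ` nonzero_nonunits R)"
proof -
  have "istopology (arbitrary union_of (\<lambda>B. B \<in> basic_open R ` nonzero_nonunits R))"
    unfolding istopology_base_eq
  proof (intro allI impI, elim conjE imageE)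
    fix S T a b
    assume a: "a \<in> nonzero_nonunits R" "S = basic_open R a"
      and b: "b \<in> nonzero_nonunits R" "T = basic_open R b"
    let ?K = "{c \<in> nonzero_nonunits R. ec R c \<in> S \<inter> T}"
    have "S \<inter> T \<subseteq> \<Union>(basic_open R ` ?K)"
    proof
      fix C assume C: "C \<in> S \<inter> T"
      then obtain c where "c \<in> nonzero_nonunits R" "C = ec R c"
        using a by (auto simp: basic_open_def)
      then show "C \<in> \<Union>(basic_open R ` ?K)"
        using C ec_in_basic_open_self by blast
    qed
    moreover have "\<Union>(basic_open R ` ?K) \<subseteq> S \<inter> T"
      using a b basic_open_mono by blast
    ultimately have "\<Union>(basic_open R ` ?K) = S \<inter> T"
      by blast
    then show "(arbitrary union_of (\<lambda>B. B \<in> basic_open R ` nonzero_nonunits R)) (S \<inter> T)"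
      unfolding union_of_def arbitrary_def by (intro exI[of _ "basic_open R ` ?K"]) auto
  qed
  then show ?thesis
    by (simp add: GD_def topology_inverse')
qed

lemma topspace_GD: "topspace (GD R) = EC R"
proof -
  have "topspace (GD R) = \<Union>(basic_open R ` nonzero_nonunits R)"
    unfolding topspace_def openin_GD union_of_def arbitrary_def by auto
  also have "\<dots> = EC R"
  proof
    show "\<Union>(basic_open R ` nonzero_nonunits R) \<subseteq> EC R"
      by (auto simp: basic_open_def EC_def ec_def intro: quotientI)
    show "EC R \<subseteq> \<Union>(basic_open R ` nonzero_nonunits R)"
      using ec_in_basic_open_self by (auto simp: EC_def quotient_def simp flip: ec_def)
  qed
  finally show ?thesis .
qed

end

end

theory Submission
  imports Defs
begin

text \<open>Everything rests on one equivalence: \<open>b\<close> divides some positive power of \<open>a\<close> exactly when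
  \<open>\<surd>(aR) \<subseteq> \<surd>(bR)\<close>. If \<open>b\<close> divides \<open>a\<^sup>n\<close> and \<open>x\<^sup>m\<close> is a multiple of \<open>a\<close>, then \<open>x\<^sup>m\<^sup>n\<close> is a
  multiple of \<open>b\<close>; conversely \<open>a\<close> itself lies in \<open>\<surd>(aR)\<close>, so some positive power of it
  lies in \<open>bR\<close>. Hence the basic open set of \<open>a\<close> is the preimage under \<open>\<rho>\<close> of the principal upper set generated by \<open>\<surd>(aR)\<close>. Since preimages commute with
  unions and every upper set is a union of principal ones, the topology of \<open>GD(R)\<close> is the initial
  topology along \<open>\<rho>\<close> for the upper Alexandrov topology on the poset of radicals
  (\<open>openin_GD_iff_vimage_upper_set\<close>).

  The rest is pure topology. The Alexandrov topology of a partial order is T0, by antisymmetry. Under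
  a surjection onto a T0 space that carries the initial topology, two points are indistinguishable iff
  they have the same image, so the Kolmogorov quotient identifies exactly the fibres and is
  homeomorphic to the target (\<open>KQ_homeomorphic_map_initial\<close>).\<close>

section \<open>Kolmogorov quotients of initial topologies\<close>

text \<open>In the initial topology the points \<open>x\<close> and \<open>x'\<close> are separated by exactly those preimages whose
  open set separates \<open>f x\<close> from \<open>f x'\<close>; the T0 property of \<open>Y\<close> turns indistinguishable images into
  equal ones.\<close>

lemma indistinguishable_initial_iff:
  assumes init: "\<And>U. openin X U \<longleftrightarrow> (\<exists>V. openin Y V \<and> U = {x \<in> topspace X. f x \<in> V})"
    and im: "f ` topspace X \<subseteq> topspace Y"
    and T0: "\<And>y z. y \<in> topspace Y \<Longrightarrow> z \<in> topspace Y \<Longrightarrow> indistinguishable Y y z \<Longrightarrow> y = z"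
    and x: "x \<in> topspace X" and x': "x' \<in> topspace X"
  shows "indistinguishable X x x' \<longleftrightarrow> f x = f x'"
proof
  assume indist: "indistinguishable X x x'"
  have "f x \<in> V \<longleftrightarrow> f x' \<in> V" if "openin Y V" for V
  proof -
    have "openin X {x \<in> topspace X. f x \<in> V}"
      using init that by blast
    then show ?thesis
      using indist x x' unfolding indistinguishable_def by blast
  qed
  then have "indistinguishable Y (f x) (f x')"
    by (simp add: indistinguishable_def)
  then show "f x = f x'"
    using T0 im x x' by blast
next
  assume "f x = f x'"
  then show "indistinguishable X x x'"
    using x x' by (auto simp: indistinguishable_def init)
qed

text \<open>The fibres of \<open>f\<close> are the indistinguishability classes, so \<open>f\<close> is constant on each class and
  separates different classes; evaluating \<open>f\<close> on any member of a class is the required bijection. It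
  is continuous because \<open>f\<close> is, and open because \<open>f\<close> is onto: an open set of \<open>X\<close> is the full preimage
  of an open \<open>V\<close>, so its image is \<open>V\<close> itself.\<close>

lemma KQ_homeomorphic_map_initial:
  assumes init: "\<And>U. openin X U \<longleftrightarrow> (\<exists>V. openin Y V \<and> U = {x \<in> topspace X. f x \<in> V})"
    and onto: "f ` topspace X = topspace Y"
    and T0: "\<And>y z. y \<in> topspace Y \<Longrightarrow> z \<in> topspace Y \<Longrightarrow> indistinguishable Y y z \<Longrightarrow> y = z"
  obtains h where "homeomorphic_map (KQ X) Y h"
    and "\<And>x. x \<in> topspace X \<Longrightarrow> h (indist_rel X `` {x}) = f x"
proof
  let ?cl = "\<lambda>x. indist_rel X `` {x}"
  define h where "h = (\<lambda>D. the_elem (f ` D))"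
  have rel: "(x, x') \<in> indist_rel X \<longleftrightarrow> x \<in> topspace X \<and> x' \<in> topspace X \<and> f x = f x'" for x x'
    using indistinguishable_initial_iff[OF init _ T0] onto by (auto simp: indist_rel_def)
  have h: "h (?cl x) = f x" if "x \<in> topspace X" for x
  proof -
    have "f ` ?cl x = {f x}"
      using that by (auto simp: rel)
    then show ?thesis
      by (simp add: h_def)
  qed
  then show "\<And>x. x \<in> topspace X \<Longrightarrow> h (?cl x) = f x" .
  have top: "topspace (KQ X) = ?cl ` topspace X"
    by (auto simp: KQ_def topspace_quotient_topology quotient_def)
  have open_KQ: "openin (KQ X) W \<longleftrightarrow> W \<subseteq> ?cl ` topspace X \<and> openin X {x \<in> topspace X. ?cl x \<in> W}"
    for W
    using top by (simp add: KQ_def openin_quotient_topology topspace_quotient_topology)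
  show "homeomorphic_map (KQ X) Y h"
  proof (rule bijective_open_imp_homeomorphic_map)
    show "h ` topspace (KQ X) = topspace Y"
      using h onto by (simp add: top image_image)
    show "inj_on h (topspace (KQ X))"
      using h by (auto simp: top inj_on_def rel)
    show "continuous_map (KQ X) Y h"
      unfolding continuous_map_def
    proof (intro conjI allI impI)
      show "h \<in> topspace (KQ X) \<rightarrow> topspace Y"
        using h onto by (auto simp: top)
    next
      fix V assume "openin Y V"
      then have "openin X {x \<in> topspace X. f x \<in> V}"
        using init by blast
      moreover have "{x \<in> topspace X. ?cl x \<in> {D \<in> topspace (KQ X). h D \<in> V}} =
          {x \<in> topspace X. f x \<in> V}"
        using h by (auto simp: top)
      ultimately show "openin (KQ X) {D \<in> topspace (KQ X). h D \<in> V}"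
        by (auto simp: open_KQ top)
    qed
    show "open_map (KQ X) Y h"
      unfolding open_map_def
    proof (intro allI impI)
      fix W assume W: "openin (KQ X) W"
      then obtain V where V: "openin Y V" "{x \<in> topspace X. ?cl x \<in> W} = {x \<in> topspace X. f x \<in> V}"
        using init open_KQ by auto
      have "W = ?cl ` {x \<in> topspace X. f x \<in> V}"
        using W unfolding open_KQ V(2)[symmetric] by blast
      then have "h ` W = f ` {x \<in> topspace X. f x \<in> V}"
        using h by (simp add: image_image)
      also have "\<dots> = topspace Y \<inter> V"
        unfolding onto[symmetric] by blast
      also have "\<dots> = V"
        using openin_subset[OF V(1)] by (rule Int_absorb1)
      finally show "openin Y (h ` W)"
        using V(1) by simp
    qed
  qed
qed

text \<open>The principal upper sets are open, so each of two indistinguishable points lies above the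
  other.\<close>

lemma upper_alexandrov_subset_T0:
  assumes "S \<in> P" "T \<in> P" "indistinguishable (upper_alexandrov P (\<subseteq>)) S T"
  shows "S = T"
proof -
  have "openin (upper_alexandrov P (\<subseteq>)) (upper_closure P (\<subseteq>) Z)" for Z
    unfolding openin_upper_alexandrov upper_set_def upper_closure_def by blast
  then have "S \<in> upper_closure P (\<subseteq>) Z \<longleftrightarrow> T \<in> upper_closure P (\<subseteq>) Z" for Z
    using assms(3) by (simp add: indistinguishable_def)
  from this[of S] this[of T] show ?thesis
    using assms(1,2) by (auto simp: upper_closure_def)
qed

section \<open>Divisors of powers and radicals of principal ideals\<close>

lemma EC_eq_image: "EC R = ec R ` nonzero_nonunits R"
  by (auto simp: EC_def quotient_def ec_def)

lemma rho_ec: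
  assumes "a \<in> nonzero_nonunits R"
  shows "rho R (ec R a) = radical R (PIdl\<^bsub>R\<^esub> a)"
proof -
  have "(\<lambda>b. radical R (PIdl\<^bsub>R\<^esub> b)) ` ec R a = {radical R (PIdl\<^bsub>R\<^esub> a)}"
    using assms by (auto simp: ec_def ec_rel_def)
  then show ?thesis
    by (simp add: rho_def)
qed

lemma rho_image_EC: "rho R ` EC R = Rpr R"
  by (auto simp: EC_eq_image Rpr_def rho_ec image_image)

context cring
begin

lemma mem_PIdl_iff_divides:
  assumes "a \<in> carrier R" "x \<in> carrier R"
  shows "x \<in> PIdl a \<longleftrightarrow> a divides x"
  using assms m_comm by (auto simp: cgenideal_def factor_def)

lemma divides_power_iff_radical_subset:
  assumes a: "a \<in> carrier R" and b: "b \<in> carrier R"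
  shows "(\<exists>n::nat. n \<ge> 1 \<and> b divides (a [^] n)) \<longleftrightarrow> radical R (PIdl a) \<subseteq> radical R (PIdl b)"
proof
  assume "\<exists>n::nat. n \<ge> 1 \<and> b divides (a [^] n)"
  then obtain n :: nat where n: "n \<ge> 1" "b divides (a [^] n)"
    by blast
  show "radical R (PIdl a) \<subseteq> radical R (PIdl b)"
  proof
    fix x assume "x \<in> radical R (PIdl a)"
    then obtain m :: nat where x: "x \<in> carrier R" and m: "m \<ge> 1" "a divides (x [^] m)"
      using a by (auto simp: radical_def mem_PIdl_iff_divides)
    obtain y where y: "y \<in> carrier R" "x [^] m = a \<otimes> y"
      using m(2) by (auto simp: factor_def)
    have "x [^] (m * n) = a [^] n \<otimes> y [^] n"
      using x y a by (simp flip: nat_pow_pow add: nat_pow_distrib)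
    then have "(a [^] n) divides (x [^] (m * n))"
      using y by (auto simp: factor_def)
    then have "b divides (x [^] (m * n))"
      using n(2) b divides_trans by blast
    moreover have "m * n \<ge> 1"
      using m n by simp
    ultimately show "x \<in> radical R (PIdl b)"
      using x b mem_PIdl_iff_divides unfolding radical_def by blast
  qed
next
  assume sub: "radical R (PIdl a) \<subseteq> radical R (PIdl b)"
  have "a [^] (1::nat) \<in> PIdl a"
    using a cgenideal_self by simp
  then have "a \<in> radical R (PIdl a)"
    unfolding radical_def using a by blast
  then obtain n :: nat where "n \<ge> 1" "a [^] n \<in> PIdl b"
    using sub unfolding radical_def by blast
  then show "\<exists>n::nat. n \<ge> 1 \<and> b divides (a [^] n)"
    using a b mem_PIdl_iff_divides by blast
qed

section \<open>The generalized divisor topology\<close>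

lemma ec_in_basic_open_iff_radical_subset:
  assumes "b \<in> nonzero_nonunits R" "a \<in> nonzero_nonunits R"
  shows "ec R b \<in> basic_open R a \<longleftrightarrow> radical R (PIdl a) \<subseteq> radical R (PIdl b)"
proof -
  have "a \<in> carrier R" "b \<in> carrier R"
    using assms by (auto simp: nonzero_nonunits_def)
  then show ?thesis
    unfolding ec_in_basic_open_iff[OF assms] by (rule divides_power_iff_radical_subset)
qed

lemma basic_open_eq_vimage_upper_closure:
  assumes a: "a \<in> nonzero_nonunits R"
  shows "basic_open R a = {C \<in> EC R. rho R C \<in> upper_closure (Rpr R) (\<subseteq>) (radical R (PIdl a))}"
proof -
  have "ec R b \<in> basic_open R a \<longleftrightarrow>
      rho R (ec R b) \<in> upper_closure (Rpr R) (\<subseteq>) (radical R (PIdl a))"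
    if "b \<in> nonzero_nonunits R" for b
    using that a by (auto simp: ec_in_basic_open_iff_radical_subset rho_ec upper_closure_def Rpr_def)
  moreover have "basic_open R a \<subseteq> EC R"
    by (auto simp: basic_open_def EC_eq_image)
  ultimately show ?thesis
    unfolding EC_eq_image by blast
qed

text \<open>A union of basic open sets is the preimage of the union of the principal upper sets of the
  generators, which is again an upper set. Conversely, an
  upper set contains the principal upper set of each of its members, so its preimage contains a basic
  neighbourhood of each of its points.\<close>

lemma openin_GD_iff_vimage_upper_set:
  "openin (GD R) U \<longleftrightarrow>
     (\<exists>V. openin (upper_alexandrov (Rpr R) (\<subseteq>)) V \<and> U = {C \<in> topspace (GD R). rho R C \<in> V})"
proof
  assume "openin (GD R) U"
  then obtain \<B> where \<B>: "\<B> \<subseteq> basic_open R ` nonzero_nonunits R" "U = \<Union>\<B>"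
    unfolding openin_GD union_of_def by blast
  then obtain A where A: "A \<subseteq> nonzero_nonunits R" "U = \<Union>(basic_open R ` A)"
    unfolding subset_image_iff by blast
  let ?V = "\<Union>a\<in>A. upper_closure (Rpr R) (\<subseteq>) (radical R (PIdl a))"
  have "openin (upper_alexandrov (Rpr R) (\<subseteq>)) ?V"
    unfolding openin_upper_alexandrov upper_set_def upper_closure_def by blast
  moreover have "U = {C \<in> topspace (GD R). rho R C \<in> ?V}"
    using A basic_open_eq_vimage_upper_closure by (auto simp: topspace_GD)
  ultimately show "\<exists>V. openin (upper_alexandrov (Rpr R) (\<subseteq>)) V \<and>
      U = {C \<in> topspace (GD R). rho R C \<in> V}"
    by blast
next
  assume "\<exists>V. openin (upper_alexandrov (Rpr R) (\<subseteq>)) V \<and> U = {C \<in> topspace (GD R). rho R C \<in> V}"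
  then obtain V where V: "upper_set (Rpr R) (\<subseteq>) V" and U: "U = {C \<in> EC R. rho R C \<in> V}"
    by (auto simp: openin_upper_alexandrov topspace_GD)
  let ?A = "{a \<in> nonzero_nonunits R. radical R (PIdl a) \<in> V}"
  have "U = \<Union>(basic_open R ` ?A)"
  proof
    show "U \<subseteq> \<Union>(basic_open R ` ?A)"
      using ec_in_basic_open_self by (auto simp: U EC_eq_image rho_ec)
    show "\<Union>(basic_open R ` ?A) \<subseteq> U"
      using V by (auto simp: U basic_open_eq_vimage_upper_closure upper_closure_def upper_set_def)
  qed
  then show "openin (GD R) U"
    unfolding openin_GD union_of_def arbitrary_def by (intro exI[of _ "basic_open R ` ?A"]) auto
qed

end

theorem theorem1p4:
  fixes R (structure)
  assumes "cring R" and "\<one> \<noteq> \<zero>"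
  shows
    "((\<forall>a \<in> nonzero_nonunits R. \<forall>b \<in> nonzero_nonunits R.
          ec R a = ec R b \<longrightarrow> radical R (PIdl a) = radical R (PIdl b)) \<and>
      (\<forall>a \<in> nonzero_nonunits R. rho R (ec R a) = radical R (PIdl a)) \<and>
      rho R ` EC R = Rpr R \<and>
      (\<forall>a \<in> nonzero_nonunits R.
          basic_open R a = {C \<in> EC R. rho R C \<in> upper_closure (Rpr R) (\<subseteq>) (radical R (PIdl a))})) \<and>
     (\<forall>a \<in> nonzero_nonunits R. \<forall>b \<in> nonzero_nonunits R.
          indistinguishable (GD R) (ec R a) (ec R b) \<longleftrightarrow>
          radical R (PIdl a) = radical R (PIdl b)) \<and>
     (\<exists>h. homeomorphic_map (KQ (GD R)) (upper_alexandrov (Rpr R) (\<subseteq>)) h \<and>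
          (\<forall>C \<in> EC R. h (indist_rel (GD R) `` {C}) = rho R C))"
proof -
  interpret cring R by fact
  let ?Y = "upper_alexandrov (Rpr R) (\<subseteq>)"
  have onto: "rho R ` topspace (GD R) = topspace ?Y"
    by (simp add: topspace_GD topspace_upper_alexandrov rho_image_EC)
  have T0: "S = T" if "S \<in> topspace ?Y" "T \<in> topspace ?Y" "indistinguishable ?Y S T" for S T
    using that upper_alexandrov_subset_T0 by (simp add: topspace_upper_alexandrov)
  have well_defined: "\<forall>a \<in> nonzero_nonunits R. \<forall>b \<in> nonzero_nonunits R.
      ec R a = ec R b \<longrightarrow> radical R (PIdl a) = radical R (PIdl b)"
    by (metis rho_ec)
  have indist: "\<forall>a \<in> nonzero_nonunits R. \<forall>b \<in> nonzero_nonunits R.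
      indistinguishable (GD R) (ec R a) (ec R b) \<longleftrightarrow> radical R (PIdl a) = radical R (PIdl b)"
  proof (intro ballI)
    fix a b assume a: "a \<in> nonzero_nonunits R" and b: "b \<in> nonzero_nonunits R"
    then have "ec R a \<in> topspace (GD R)" "ec R b \<in> topspace (GD R)"
      by (simp_all add: topspace_GD EC_eq_image)
    then show "indistinguishable (GD R) (ec R a) (ec R b) \<longleftrightarrow>
        radical R (PIdl a) = radical R (PIdl b)"
      using indistinguishable_initial_iff[OF openin_GD_iff_vimage_upper_set _ T0] onto
      by (simp add: rho_ec a b)
  qed
  obtain h where h: "homeomorphic_map (KQ (GD R)) ?Y h"
    "\<And>C. C \<in> topspace (GD R) \<Longrightarrow> h (indist_rel (GD R) `` {C}) = rho R C"
    using KQ_homeomorphic_map_initial[OF openin_GD_iff_vimage_upper_set onto T0] by blast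
  have homeo: "\<exists>h. homeomorphic_map (KQ (GD R)) ?Y h \<and>
      (\<forall>C \<in> EC R. h (indist_rel (GD R) `` {C}) = rho R C)"
    using h unfolding topspace_GD by blast
  show ?thesis
    by (intro conjI well_defined rho_image_EC indist homeo ballI rho_ec
        basic_open_eq_vimage_upper_closure)
qed

end
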